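(* Let $d\in\{1,2,3\}$, let $\Omega\subset\mathbb{R}^d$ be a bounded domain with smooth boundary, let $p\in L^\infty(\Omega)$ with $p(x)\ge0$, and let $U\subset\subset\Omega$ be a subdomain. Then there is a positive constant $C$ that depends on $d,U,\Omega$ such that for every constant $\lambda>0$ and every $C^2$ solution $u\ge0$ of $$-\Delta u+(\lambda+p(x))u=0\quad\text{in }\Omega$$ one has $$\sup_U u\le e^{C(1+\lambda)}\inf_U u.$$
   Context: $U\subset\subset\Omega$ means that the closure of $U$ is a compact subset of $\Omega$. The potential $p$ is the fixed zeroth-order coefficient. *)

theory Defs
  imports "HOL-Analysis.Analysis"
begin

definition partial_deriv :: "'a \<Rightarrow> ('a::euclidean_space \<Rightarrow> real) \<Rightarrow> 'a \<Rightarrow> real" where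
  "partial_deriv i f x = frechet_derivative f (at x) i"

definition laplacian :: "('a::euclidean_space \<Rightarrow> real) \<Rightarrow> 'a \<Rightarrow> real" where
  "laplacian f x = (\<Sum>i\<in>Basis. partial_deriv i (partial_deriv i f) x)"

(* Meant for open S only, where derivatives at x and at x within S agree. *)
primrec Ck_on :: "nat \<Rightarrow> ('a::euclidean_space \<Rightarrow> real) \<Rightarrow> 'a set \<Rightarrow> bool" where
  "Ck_on 0 f S = continuous_on S f"
| "Ck_on (Suc k) f S =
     ((\<forall>x\<in>S. f differentiable (at x)) \<and> (\<forall>i\<in>Basis. Ck_on k (partial_deriv i f) S))"

definition smooth_on :: "('a::euclidean_space \<Rightarrow> real) \<Rightarrow> 'a set \<Rightarrow> bool" where
  "smooth_on f S \<longleftrightarrow> (\<forall>k. Ck_on k f S)"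

(* Near each boundary point, in suitable orthonormal coordinates, the set is the part lying
   strictly above the graph of a smooth function g of d - 1 variables.  The unit vector e is the
   vertical direction; g is applied to the orthogonal projection of x onto the complement
   of e, so only its restriction to that (d - 1)-dimensional subspace matters. *)
definition smooth_boundary :: "'a::euclidean_space set \<Rightarrow> bool" where
  "smooth_boundary S \<longleftrightarrow>
     (\<forall>z\<in>frontier S. \<exists>r>0. \<exists>e g. norm e = 1 \<and> smooth_on g UNIV \<and>
        S \<inter> ball z r = {x \<in> ball z r. g (x - (x \<bullet> e) *\<^sub>R e) < x \<bullet> e})"

definition Linfty_on :: "'a::euclidean_space set \<Rightarrow> ('a \<Rightarrow> real) \<Rightarrow> bool" where
  "Linfty_on S f \<longleftrightarrow>
     f \<in> borel_measurable (lebesgue_on S) \<and> (\<exists>M. AE x in lebesgue_on S. \<bar>f x\<bar> \<le> M)"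

definition compactly_contained :: "'a::topological_space set \<Rightarrow> 'a set \<Rightarrow> bool" where
  "compactly_contained U S \<longleftrightarrow> compact (closure U) \<and> closure U \<subseteq> S"

(* Functions in Linfty are only determined up to null sets, so the equation is required almost
   everywhere, while u itself is a classical twice continuously differentiable function. *)
definition C2_solution ::
  "'a::euclidean_space set \<Rightarrow> ('a \<Rightarrow> real) \<Rightarrow> real \<Rightarrow> ('a \<Rightarrow> real) \<Rightarrow> bool" where
  "C2_solution S p lam u \<longleftrightarrow>
     Ck_on 2 u S \<and> (AE x in lebesgue_on S. - laplacian u x + (lam + p x) * u x = 0)"

end

theory Submission
  imports Defs
begin

text \<open>
  With \<open>L = \<lambda> + M\<close>, where \<open>M\<close> bounds \<open>p\<close> from above, a nonnegative solution satisfies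
  \<open>0 \<le> \<Delta>u \<le> L u\<close>: almost everywhere by the equation, hence everywhere, because \<open>u\<close> and \<open>\<Delta>u\<close>
  are continuous.

  Average \<open>u\<close> over balls with the weight \<open>cap y = max 0 (1 - |y|\<^sup>2)\<close>, that is, put
  \<open>A\<^sub>x(s) = \<integral> u(x + s y) cap(y) dy\<close>. Since \<open>y cap(y)\<close> is the gradient of \<open>- cap(y)\<^sup>2 / 4\<close>,
  differentiating under the integral and integrating by parts gives
  \<open>A\<^sub>x'(s) = (s/4) \<integral> \<Delta>u(x + s y) cap(y)\<^sup>2 dy\<close>. As \<open>0 \<le> cap\<^sup>2 \<le> cap\<close>, the bounds on the Laplacian
  become \<open>0 \<le> A\<^sub>x' \<le> (s L/4) A\<^sub>x\<close>, and Gronwall's argument yields the two-sided mean value property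
  \<open>A\<^sub>x(0) \<le> A\<^sub>x(s) \<le> exp(L s\<^sup>2/8) A\<^sub>x(0)\<close>, where \<open>A\<^sub>x(0)\<close> is a fixed positive multiple of \<open>u(x)\<close>
  (lemma \<open>cap_integral_bounds\<close>).

  If \<open>|x - z| \<le> r\<close>, the ball of radius \<open>r\<close> about \<open>x\<close> lies in the half-size core of the ball of
  radius \<open>4 r\<close> about \<open>z\<close>, so \<open>A\<^sub>x(r)\<close> is at most a constant times \<open>A\<^sub>z(4 r)\<close>. This is a Harnack
  inequality at the fixed scale \<open>r\<close> with constant \<open>exp(O(1 + \<lambda>))\<close> (lemma \<open>local_harnack\<close>). The
  radius depends only on the dimension and the distance from \<open>U\<close> to the complement of
  \<open>\<Omega>\<close>, so any two points of the connected compact closure of \<open>U\<close> are joined by a chain of steps of length at most \<open>r\<close> whose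
  number is bounded independently of \<open>u\<close> and \<open>\<lambda>\<close> (lemma \<open>uniform_harnack_chain\<close>); multiplying
  the local inequalities along the chain keeps the form \<open>exp(C (1 + \<lambda>))\<close>.
\<close>

section \<open>Functions of class C2\<close>

lemma Ck_on_2D:
  fixes u :: "'a::euclidean_space \<Rightarrow> real"
  assumes "Ck_on 2 u S"
  shows Ck_on_2_differentiable: "\<And>x. x \<in> S \<Longrightarrow> u differentiable (at x)"
    and Ck_on_2_partial_differentiable:
      "\<And>x i. x \<in> S \<Longrightarrow> i \<in> Basis \<Longrightarrow> partial_deriv i u differentiable (at x)"
    and Ck_on_2_continuous: "continuous_on S u"
    and Ck_on_2_partial_continuous: "\<And>i. i \<in> Basis \<Longrightarrow> continuous_on S (partial_deriv i u)"
    and Ck_on_2_second_partial_continuous: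
      "\<And>i. i \<in> Basis \<Longrightarrow> continuous_on S (partial_deriv i (partial_deriv i u))"
    and Ck_on_2_laplacian_continuous: "continuous_on S (laplacian u)"
proof -
  show 1: "\<And>x. x \<in> S \<Longrightarrow> u differentiable (at x)"
    and 2: "\<And>x i. x \<in> S \<Longrightarrow> i \<in> Basis \<Longrightarrow> partial_deriv i u differentiable (at x)"
    and 3: "\<And>i. i \<in> Basis \<Longrightarrow> continuous_on S (partial_deriv i (partial_deriv i u))"
    using assms by (auto simp: numeral_2_eq_2)
  show "continuous_on S u" "\<And>i. i \<in> Basis \<Longrightarrow> continuous_on S (partial_deriv i u)"
    using 1 2 by (auto intro!: continuous_at_imp_continuous_on differentiable_imp_continuous_within)
  show "continuous_on S (laplacian u)"
    unfolding laplacian_def[abs_def] by (intro continuous_intros 3)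
qed

lemma has_real_derivative_along_curve:
  fixes f :: "'a::euclidean_space \<Rightarrow> real"
  assumes "f differentiable (at (g t))" and g: "(g has_vector_derivative v) (at t)"
  shows "((\<lambda>h. f (g h)) has_real_derivative (\<Sum>i\<in>Basis. (v \<bullet> i) * partial_deriv i f (g t))) (at t)"
proof -
  let ?D = "frechet_derivative f (at (g t))"
  have D: "(f has_derivative ?D) (at (g t))"
    using assms(1) by (simp add: frechet_derivative_works)
  then have lin: "linear ?D"
    by (rule has_derivative_linear)
  have "((\<lambda>h. f (g h)) has_derivative (\<lambda>h. ?D (h *\<^sub>R v))) (at t)"
    using has_derivative_compose[OF g[unfolded has_vector_derivative_def] D] .
  moreover have "?D (h *\<^sub>R v) = (\<Sum>i\<in>Basis. (v \<bullet> i) * partial_deriv i f (g t)) * h" for h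
  proof -
    have "?D (h *\<^sub>R v) = h * ?D (\<Sum>i\<in>Basis. (v \<bullet> i) *\<^sub>R i)"
      by (simp add: linear_scale[OF lin] euclidean_representation)
    also have "?D (\<Sum>i\<in>Basis. (v \<bullet> i) *\<^sub>R i) = (\<Sum>i\<in>Basis. (v \<bullet> i) * partial_deriv i f (g t))"
      by (simp add: linear_sum[OF lin] linear_scale[OF lin] partial_deriv_def)
    finally show ?thesis by simp
  qed
  ultimately show ?thesis
    by (simp add: has_field_derivative_def)
qed

section \<open>The weight\<close>

lemma real_DIM_ge_1: "1 \<le> real DIM('a::euclidean_space)"
  using DIM_positive[where 'a='a] by linarith

text \<open>
  This weight is chosen because \<open>y \<mapsto> cap y *\<^sub>R y\<close> is a gradient, that of \<open>y \<mapsto> - (cap y)\<^sup>2 / 4\<close>,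
  and because \<open>cap\<^sup>2\<close> is still of class C1 across the unit sphere, so that it can be used in an
  integration by parts without boundary terms.
\<close>
definition cap :: "'a::euclidean_space \<Rightarrow> real" where
  "cap y = max 0 (1 - y \<bullet> y)"

lemma cap_nonneg: "0 \<le> cap y" and cap_le_1: "cap y \<le> 1"
  by (auto simp: cap_def)

lemma cap_eq_0: "1 \<le> norm y \<Longrightarrow> cap y = 0"
  using power_mono[of 1 "norm y" 2] by (simp add: cap_def power2_norm_eq_inner)

lemma cap_ge: assumes "norm y \<le> 1/2" shows "3/4 \<le> cap y"
  using power_mono[OF assms, of 2] by (simp add: cap_def power2_norm_eq_inner power_divide)

lemma continuous_on_cap [continuous_intros]:
  "continuous_on A f \<Longrightarrow> continuous_on A (\<lambda>x. cap (f x))"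
  unfolding cap_def by (intro continuous_intros)

text \<open>
  Squaring removes the kink of the positive part at \<open>0\<close>, where the difference quotient is again
  the positive part of the increment.
\<close>
lemma has_real_derivative_pos_part_squared:
  "((\<lambda>t::real. (max 0 t)\<^sup>2) has_real_derivative 2 * max 0 t) (at t)"
proof -
  consider "t < 0" | "t > 0" | "t = 0" by linarith
  then show ?thesis
  proof cases
    case 1
    have "((\<lambda>t::real. 0) has_real_derivative 2 * max 0 t) (at t)"
      using 1 by auto
    then show ?thesis
      by (rule has_field_derivative_transform_within_open[where S="{..<0}"]) (use 1 in auto)
  next
    case 2
    have "((\<lambda>t::real. t\<^sup>2) has_real_derivative 2 * max 0 t) (at t)"
      using 2 by (auto intro!: derivative_eq_intros)
    then show ?thesis
      by (rule has_field_derivative_transform_within_open[where S="{0<..}"]) (use 2 in auto)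
  next
    case 3
    have "((\<lambda>h::real. max 0 h) \<longlongrightarrow> max 0 0) (at 0)"
      by (intro tendsto_intros)
    moreover have "\<forall>\<^sub>F h::real in at 0. max 0 h = (max 0 (0 + h))\<^sup>2 / h"
      by (auto simp: eventually_at_filter max_def power2_eq_square)
    ultimately have "((\<lambda>h::real. ((max 0 (0 + h))\<^sup>2 - (max 0 0)\<^sup>2) / h) \<longlongrightarrow> 0) (at 0)"
      by (auto elim: Lim_transform_eventually)
    then show ?thesis using 3 by (simp add: DERIV_def)
  qed
qed

lemma has_real_derivative_cap_squared:
  "((\<lambda>h. (cap (y + h *\<^sub>R i))\<^sup>2) has_real_derivative - 4 * (y \<bullet> i) * cap y) (at 0)"
proof -
  have "((\<lambda>h. 1 - (y + h *\<^sub>R i) \<bullet> (y + h *\<^sub>R i)) has_real_derivative - 2 * (y \<bullet> i)) (at 0)"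
    by (simp add: inner_add_left inner_add_right inner_commute)
       (auto intro!: derivative_eq_intros simp: inner_commute)
  from DERIV_chain2[where x=0, OF has_real_derivative_pos_part_squared this]
  show ?thesis by (simp add: cap_def mult_ac)
qed

section \<open>Integrals of compactly supported functions\<close>

text \<open>
  Differentiation under the integral is available over boxes, while translations and dilations act
  most simply on integrals over the whole space. The box below contains the ball of radius \<open>2\<close>; it
  is larger than the unit ball, the support of \<open>cap\<close>, so that translates by less than \<open>1\<close> of
  functions supported in the unit ball still vanish off it.
\<close>
abbreviation support_box :: "'a::euclidean_space set" where
  "support_box \<equiv> cbox (- (2 *\<^sub>R One)) (2 *\<^sub>R One)"

lemma in_support_box: "norm y < 2 \<Longrightarrow> y \<in> support_box"
  using Basis_le_norm[of _ y] by (fastforce simp: mem_box)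

lemma norm_support_box:
  assumes "(y::'a::euclidean_space) \<in> support_box" shows "norm y \<le> 2 * real DIM('a)"
proof -
  have "norm y \<le> (\<Sum>b\<in>Basis. \<bar>y \<bullet> b\<bar>)" by (rule norm_le_l1)
  also have "\<dots> \<le> (\<Sum>b\<in>(Basis::'a set). 2)"
    using assms by (intro sum_mono) (auto simp: mem_box abs_le_iff minus_le_iff)
  finally show ?thesis by simp
qed

lemma has_integral_support_box_iff:
  fixes f :: "'a::euclidean_space \<Rightarrow> real"
  assumes "\<And>y. 2 \<le> norm y \<Longrightarrow> f y = 0"
  shows "(f has_integral I) support_box \<longleftrightarrow> (f has_integral I) UNIV"
proof -
  have "f y = 0" if "y \<notin> support_box" for y
    using assms[of y] in_support_box[of y] that by linarith
  then have "f = (\<lambda>y. if y \<in> support_box then f y else 0)"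
    by auto
  then show ?thesis
    using has_integral_restrict_UNIV[of support_box f I] by simp
qed

lemma integrable_on_UNIV_if_supported:
  fixes f :: "'a::euclidean_space \<Rightarrow> real"
  assumes "continuous_on support_box f" and "\<And>y. 2 \<le> norm y \<Longrightarrow> f y = 0"
  shows "f integrable_on UNIV"
  using integrable_continuous[OF assms(1)] has_integral_support_box_iff[of f, OF assms(2)]
  by (auto simp: integrable_on_def)

lemma has_integral_UNIV_affinity:
  fixes f :: "'a::euclidean_space \<Rightarrow> real"
  assumes f: "(f has_integral I) UNIV" and supp: "\<And>y. 2 \<le> norm y \<Longrightarrow> f y = 0" and "m > 0"
  shows "((\<lambda>y. f (m *\<^sub>R y + c)) has_integral I / m ^ DIM('a)) UNIV"
proof -
  let ?B = "cbox ((- (2 *\<^sub>R One) - c) /\<^sub>R m) ((2 *\<^sub>R One - c) /\<^sub>R m) :: 'a set"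
  have "((\<lambda>y. f (m *\<^sub>R y + c)) has_integral (I /\<^sub>R m ^ DIM('a))) ?B"
    using f has_integral_support_box_iff[of f, OF supp] \<open>m > 0\<close> by (intro has_integral_affinity') auto
  moreover have "f (m *\<^sub>R y + c) = 0" if "y \<notin> ?B" for y
  proof (rule supp, rule ccontr)
    assume "\<not> 2 \<le> norm (m *\<^sub>R y + c)"
    then have "m *\<^sub>R y + c \<in> support_box" by (intro in_support_box) auto
    then have "y \<in> ?B"
      using \<open>m > 0\<close> by (auto simp: mem_box inner_diff_left inner_add_left field_simps)
    with that show False by simp
  qed
  ultimately show ?thesis
    using has_integral_on_superset[of _ _ ?B UNIV] by (auto simp: divide_inverse mult_ac)
qed

lemma has_derivative_integral_UNIV:
  fixes f f' :: "real \<Rightarrow> 'a::euclidean_space \<Rightarrow> real"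
  assumes deriv: "\<And>s y. s \<in> {a<..<b} \<Longrightarrow> y \<in> support_box \<Longrightarrow>
                    ((\<lambda>s. f s y) has_real_derivative f' s y) (at s)"
    and cont: "\<And>s. s \<in> {a<..<b} \<Longrightarrow> continuous_on support_box (f s)"
    and cont': "continuous_on ({a<..<b} \<times> support_box) (\<lambda>(s, y). f' s y)"
    and supp: "\<And>s y. 2 \<le> norm y \<Longrightarrow> s \<in> {a<..<b} \<Longrightarrow> f s y = 0"
      "\<And>s y. 2 \<le> norm y \<Longrightarrow> s \<in> {a<..<b} \<Longrightarrow> f' s y = 0"
    and s: "s \<in> {a<..<b}"
  shows "((\<lambda>s. integral UNIV (f s)) has_real_derivative integral UNIV (f' s)) (at s)"
proof -
  have UNIV_eq: "integral UNIV (g s) = integral support_box (g s)"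
    if "\<And>y. 2 \<le> norm y \<Longrightarrow> g s y = 0" for g :: "real \<Rightarrow> 'a \<Rightarrow> real" and s
    unfolding integral_def integrable_on_def using has_integral_support_box_iff[of "g s"] that by simp
  have "((\<lambda>s. integral support_box (f s)) has_real_derivative integral support_box (f' s))
          (at s within {a<..<b})"
    by (rule leibniz_rule_field_derivative)
       (use s deriv cont' cont in \<open>auto intro: has_field_derivative_at_within integrable_continuous\<close>)
  then have "((\<lambda>s. integral support_box (f s)) has_real_derivative integral UNIV (f' s)) (at s)"
    using s supp(2) UNIV_eq[of f' s] by (simp add: at_within_open[OF s])
  then show ?thesis
    by (rule has_field_derivative_transform_within_open[where S="{a<..<b}"])
       (use s supp(1) UNIV_eq[of f] in auto)
qed

text \<open>
  The integral of \<open>F\<close> does not change when \<open>F\<close> is translated along \<open>i\<close>; differentiating this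
  constant with respect to the translation gives the integral of the derivative. This replaces
  the divergence theorem. Points of \<open>support_box\<close> have norm at most twice the dimension and the
  translation has length less than \<open>1\<close>, so every translate is evaluated inside the ball of radius
  four times the dimension.
\<close>
lemma integral_directional_derivative_eq_0:
  fixes F F' :: "'a::euclidean_space \<Rightarrow> real"
  assumes i: "norm i = 1"
    and supp: "\<And>y. 1 \<le> norm y \<Longrightarrow> F y = 0" "\<And>y. 1 \<le> norm y \<Longrightarrow> F' y = 0"
    and deriv: "\<And>y. norm y < 4 * real DIM('a) \<Longrightarrow>
                  ((\<lambda>h. F (y + h *\<^sub>R i)) has_real_derivative F' y) (at 0)"
    and cont: "continuous_on (ball 0 (4 * real DIM('a))) F"
      "continuous_on (ball 0 (4 * real DIM('a))) F'"
  shows "(F' has_integral 0) UNIV"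
proof -
  have in_ball: "norm (y + h *\<^sub>R i) < 4 * real DIM('a)" if "h \<in> {-1<..<1}" "y \<in> support_box" for h y
  proof -
    have "norm (h *\<^sub>R i) < 1" using that i by auto
    then show ?thesis
      using norm_triangle_ineq[of y "h *\<^sub>R i"] norm_support_box[OF that(2)] real_DIM_ge_1[where 'a='a] by linarith
  qed
  have far: "1 \<le> norm (y + h *\<^sub>R i)" if "2 \<le> norm y" "h \<in> {-1<..<1}" for h y
    using norm_triangle_ineq4[of "y + h *\<^sub>R i" "h *\<^sub>R i"] that i by auto
  have box: "support_box \<subseteq> ball (0::'a) (4 * real DIM('a))"
    using in_ball[of 0] by auto
  have int: "F integrable_on UNIV" "F' integrable_on UNIV"
    using supp cont box by (auto intro!: integrable_on_UNIV_if_supported intro: continuous_on_subset)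
  have "((\<lambda>h. integral UNIV (\<lambda>y. F (y + h *\<^sub>R i))) has_real_derivative
          integral UNIV (\<lambda>y. F' (y + 0 *\<^sub>R i))) (at 0)"
  proof (rule has_derivative_integral_UNIV[where a="-1" and b=1])
    fix h y assume h: "h \<in> {-1<..<1::real}" and y: "y \<in> (support_box :: 'a set)"
    have "((\<lambda>k. F (y + h *\<^sub>R i + k *\<^sub>R i)) has_real_derivative F' (y + h *\<^sub>R i)) (at 0)"
      by (rule deriv[OF in_ball[OF h y]])
    then have "((\<lambda>k. F (y + (k + h) *\<^sub>R i)) has_real_derivative F' (y + h *\<^sub>R i)) (at 0)"
      by (simp add: algebra_simps)
    then show "((\<lambda>h. F (y + h *\<^sub>R i)) has_real_derivative F' (y + h *\<^sub>R i)) (at h)"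
      using DERIV_shift[of "\<lambda>h. F (y + h *\<^sub>R i)" _ 0 h] by simp
  next
    fix h :: real assume h: "h \<in> {-1<..<1}"
    show "continuous_on support_box (\<lambda>y. F (y + h *\<^sub>R i))"
      by (rule continuous_on_compose2[OF cont(1)]) (use in_ball h in \<open>auto intro!: continuous_intros\<close>)
  next
    show "continuous_on ({-1<..<1} \<times> support_box) (\<lambda>(h, y). F' (y + h *\<^sub>R i))"
      unfolding split_beta
      by (rule continuous_on_compose2[OF cont(2)]) (use in_ball in \<open>auto intro!: continuous_intros\<close>)
  qed (use supp far in auto)
  moreover have "integral UNIV (\<lambda>y. F (y + h *\<^sub>R i)) = integral UNIV F" for h
    using has_integral_UNIV_affinity[OF integrable_integral[OF int(1)], of 1 "h *\<^sub>R i"] supp(1)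
    by (auto intro: integral_unique)
  ultimately have "((\<lambda>h::real. integral UNIV F) has_real_derivative integral UNIV F') (at 0)"
    by simp
  from DERIV_unique[OF this] have "integral UNIV F' = 0" by simp
  with int(2) show ?thesis by (simp add: has_integral_iff)
qed


section \<open>Weighted averages of functions with controlled Laplacian\<close>

definition cap_integral :: "('a::euclidean_space \<Rightarrow> real) \<Rightarrow> 'a \<Rightarrow> real \<Rightarrow> real" where
  "cap_integral u x s = integral UNIV (\<lambda>y. u (x + s *\<^sub>R y) * cap y)"

lemma scaled_point_in:
  fixes x y :: "'a::euclidean_space"
  assumes "ball x (4 * real DIM('a) * r) \<subseteq> S" "\<bar>s\<bar> < r" "norm y < 4 * real DIM('a)"
  shows "x + s *\<^sub>R y \<in> S"
proof -
  have "norm (s *\<^sub>R y) < r * (4 * real DIM('a))"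
    using mult_strict_mono'[OF assms(2,3)] by simp
  then have "x + s *\<^sub>R y \<in> ball x (4 * real DIM('a) * r)"
    by (simp add: dist_norm mult_ac)
  with assms(1) show ?thesis by blast
qed

lemma norm_support_box_less:
  "(y::'a::euclidean_space) \<in> support_box \<Longrightarrow> norm y < 4 * real DIM('a)"
  using norm_support_box[of y] real_DIM_ge_1[where 'a='a] by linarith

lemma continuous_on_scaled:
  fixes x :: "'a::euclidean_space"
  assumes "continuous_on S f" "ball x (4 * real DIM('a) * r) \<subseteq> S" "\<bar>s\<bar> < r"
  shows "continuous_on (ball 0 (4 * real DIM('a))) (\<lambda>y. f (x + s *\<^sub>R y))"
  by (rule continuous_on_compose2[OF assms(1)])
     (use scaled_point_in[OF assms(2,3)] in \<open>auto intro!: continuous_intros\<close>)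

lemma scaled_cap_integrable:
  fixes x :: "'a::euclidean_space" and f :: "'a \<Rightarrow> real"
  assumes "continuous_on S f" "ball x (4 * real DIM('a) * r) \<subseteq> S" "\<bar>s\<bar> < r" "n > 0"
  shows "(\<lambda>y. f (x + s *\<^sub>R y) * cap y ^ n) integrable_on UNIV"
proof (rule integrable_on_UNIV_if_supported)
  have "continuous_on support_box (\<lambda>y. f (x + s *\<^sub>R y))"
    by (rule continuous_on_subset[OF continuous_on_scaled[OF assms(1-3)]])
       (auto dest: norm_support_box_less)
  then show "continuous_on support_box (\<lambda>y. f (x + s *\<^sub>R y) * cap y ^ n)"
    by (intro continuous_intros)
qed (use assms(4) in \<open>auto simp: cap_eq_0\<close>)

text \<open>
  Differentiating under the integral produces \<open>\<nabla>u(x + s y) \<bullet> y cap(y)\<close>. Since \<open>4 y cap(y)\<close> is minus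
  the gradient of \<open>cap(y)\<^sup>2\<close>, an integration by parts in each coordinate moves the derivative to
  \<open>\<nabla>u(x + s y)\<close>, which yields the Laplacian and one factor \<open>s\<close>.
\<close>
lemma has_real_derivative_cap_integral:
  fixes u :: "'a::euclidean_space \<Rightarrow> real"
  assumes u: "Ck_on 2 u S" and S: "ball x (4 * real DIM('a) * r) \<subseteq> S" and s: "\<bar>s\<bar> < r"
  shows "(cap_integral u x has_real_derivative
           s / 4 * integral UNIV (\<lambda>y. laplacian u (x + s *\<^sub>R y) * (cap y)\<^sup>2)) (at s)"
proof -
  let ?g = "\<lambda>t y. \<Sum>i\<in>Basis. (y \<bullet> i) * partial_deriv i u (x + t *\<^sub>R y)"
  have box_in: "x + t *\<^sub>R y \<in> S" if "t \<in> {-r<..<r}" "y \<in> support_box" for t y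
    using scaled_point_in[OF S _ norm_support_box_less[OF that(2)]] that(1) by auto
  have "((\<lambda>t. integral UNIV (\<lambda>y. u (x + t *\<^sub>R y) * cap y)) has_real_derivative
          integral UNIV (\<lambda>y. ?g s y * cap y)) (at s)"
  proof (rule has_derivative_integral_UNIV[where a="-r" and b=r])
    fix t y assume t: "t \<in> {-r<..<r}" and y: "y \<in> (support_box :: 'a set)"
    have "((\<lambda>t. u (x + t *\<^sub>R y)) has_real_derivative ?g t y) (at t)"
      by (rule has_real_derivative_along_curve)
         (use Ck_on_2_differentiable[OF u box_in[OF t y]] in
           \<open>auto intro!: derivative_eq_intros\<close>)
    then show "((\<lambda>t. u (x + t *\<^sub>R y) * cap y) has_real_derivative ?g t y * cap y) (at t)"
      by (rule DERIV_cmult_right)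
  next
    fix t assume t: "t \<in> {-r<..<r}"
    have "continuous_on support_box (\<lambda>y. u (x + t *\<^sub>R y))"
      by (rule continuous_on_compose2[OF Ck_on_2_continuous[OF u]])
         (use t box_in in \<open>auto intro!: continuous_intros\<close>)
    then show "continuous_on support_box (\<lambda>y. u (x + t *\<^sub>R y) * cap y)"
      by (intro continuous_intros)
  next
    have "continuous_on ({-r<..<r} \<times> support_box)
        (\<lambda>z. partial_deriv i u (x + fst z *\<^sub>R snd z))" if "i \<in> Basis" for i
      by (rule continuous_on_compose2[OF Ck_on_2_partial_continuous[OF u that]])
         (use box_in in \<open>auto intro!: continuous_intros\<close>)
    then show "continuous_on ({-r<..<r} \<times> support_box) (\<lambda>(t, y). ?g t y * cap y)"
      unfolding split_beta by (intro continuous_intros) auto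
  qed (use s in \<open>auto simp: cap_eq_0\<close>)
  then have deriv: "(cap_integral u x has_real_derivative integral UNIV (\<lambda>y. ?g s y * cap y)) (at s)"
    by (simp add: cap_integral_def[abs_def])
  \<comment> \<open>integration by parts in the coordinate \<open>i\<close>: the integrand is the \<open>i\<close>-th derivative of
      \<open>\<partial>\<^sub>iu(x + s y) cap(y)\<^sup>2\<close>\<close>
  have parts: "((\<lambda>y. s * partial_deriv i (partial_deriv i u) (x + s *\<^sub>R y) * (cap y)\<^sup>2
          - 4 * ((y \<bullet> i) * partial_deriv i u (x + s *\<^sub>R y) * cap y)) has_integral 0) UNIV"
    (is "(?F' has_integral 0) UNIV") if i: "i \<in> Basis" for i
  proof (rule integral_directional_derivative_eq_0
      [where F = "\<lambda>y. partial_deriv i u (x + s *\<^sub>R y) * (cap y)\<^sup>2" and i = i])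
    fix y :: 'a assume y: "norm y < 4 * real DIM('a)"
    have "((\<lambda>h. partial_deriv i u (x + s *\<^sub>R (y + h *\<^sub>R i))) has_real_derivative
        (\<Sum>j\<in>Basis. ((s *\<^sub>R i) \<bullet> j) * partial_deriv j (partial_deriv i u) (x + s *\<^sub>R (y + 0 *\<^sub>R i)))) (at 0)"
      by (rule has_real_derivative_along_curve)
         (use Ck_on_2_partial_differentiable[OF u scaled_point_in[OF S s y] i] in
           \<open>auto intro!: derivative_eq_intros\<close>)
    also have "(\<Sum>j\<in>Basis. ((s *\<^sub>R i) \<bullet> j) * partial_deriv j (partial_deriv i u) (x + s *\<^sub>R (y + 0 *\<^sub>R i)))
        = (\<Sum>j\<in>Basis. if j = i then s * partial_deriv j (partial_deriv i u) (x + s *\<^sub>R y) else 0)"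
      using i by (intro sum.cong) (auto simp: inner_Basis)
    also have "\<dots> = s * partial_deriv i (partial_deriv i u) (x + s *\<^sub>R y)"
      using i by simp
    finally have "((\<lambda>h. partial_deriv i u (x + s *\<^sub>R (y + h *\<^sub>R i))) has_real_derivative
        s * partial_deriv i (partial_deriv i u) (x + s *\<^sub>R y)) (at 0)" .
    from DERIV_mult[OF this has_real_derivative_cap_squared[of y i]]
    show "((\<lambda>h. partial_deriv i u (x + s *\<^sub>R (y + h *\<^sub>R i)) * (cap (y + h *\<^sub>R i))\<^sup>2)
        has_real_derivative ?F' y) (at 0)"
      by (simp add: mult_ac)
  qed (use i in \<open>auto simp: cap_eq_0 intro!: continuous_intros continuous_on_scaled[OF _ S s]
         Ck_on_2_partial_continuous[OF u] Ck_on_2_second_partial_continuous[OF u]\<close>)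
  have int_g: "(\<lambda>y. ?g s y * cap y) integrable_on UNIV"
  proof (rule integrable_on_UNIV_if_supported)
    have "continuous_on support_box (\<lambda>y. partial_deriv i u (x + s *\<^sub>R y))" if "i \<in> Basis" for i
      by (rule continuous_on_compose2[OF Ck_on_2_partial_continuous[OF u that]])
         (use s box_in[of s] in \<open>auto simp: abs_less_iff minus_less_iff intro!: continuous_intros\<close>)
    then show "continuous_on support_box (\<lambda>y. ?g s y * cap y)"
      by (intro continuous_intros) auto
  qed (auto simp: cap_eq_0)
  have "((\<lambda>y. (\<Sum>i\<in>Basis. s * partial_deriv i (partial_deriv i u) (x + s *\<^sub>R y) * (cap y)\<^sup>2
          - 4 * ((y \<bullet> i) * partial_deriv i u (x + s *\<^sub>R y) * cap y)) + 4 * (?g s y * cap y))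
        has_integral (\<Sum>i\<in>(Basis::'a set). 0) + 4 * integral UNIV (\<lambda>y. ?g s y * cap y)) UNIV"
    by (intro has_integral_add has_integral_sum parts has_integral_mult_right
          integrable_integral int_g finite_Basis)
  then have "((\<lambda>y. s * (laplacian u (x + s *\<^sub>R y) * (cap y)\<^sup>2)) has_integral
        4 * integral UNIV (\<lambda>y. ?g s y * cap y)) UNIV"
    by (simp add: laplacian_def sum_subtractf sum_distrib_left sum_distrib_right mult_ac)
  moreover have "((\<lambda>y. s * (laplacian u (x + s *\<^sub>R y) * (cap y)\<^sup>2)) has_integral
        s * integral UNIV (\<lambda>y. laplacian u (x + s *\<^sub>R y) * (cap y)\<^sup>2)) UNIV"
    using scaled_cap_integrable[OF Ck_on_2_laplacian_continuous[OF u] S s, of 2]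
    by (intro has_integral_mult_right integrable_integral) simp
  ultimately have "4 * integral UNIV (\<lambda>y. ?g s y * cap y)
      = s * integral UNIV (\<lambda>y. laplacian u (x + s *\<^sub>R y) * (cap y)\<^sup>2)"
    by (rule has_integral_unique)
  then have "integral UNIV (\<lambda>y. ?g s y * cap y)
      = s / 4 * integral UNIV (\<lambda>y. laplacian u (x + s *\<^sub>R y) * (cap y)\<^sup>2)"
    by simp
  with deriv show ?thesis by simp
qed

lemma cap_integral_0: "cap_integral u (x::'a::euclidean_space) 0 = u x * integral UNIV (cap :: 'a \<Rightarrow> real)"
  by (simp add: cap_integral_def)

text \<open>
  A mean value property with error factor: subharmonicity makes the average grow with the radius,
  and \<open>\<Delta>u \<le> L u\<close> together with \<open>cap\<^sup>2 \<le> cap\<close> bounds its logarithmic derivative by \<open>L s / 4\<close>.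
\<close>
lemma cap_integral_bounds:
  fixes u :: "'a::euclidean_space \<Rightarrow> real"
  assumes u: "Ck_on 2 u S" and S: "ball x (4 * real DIM('a) * r) \<subseteq> S" and s: "0 \<le> s" "s < r"
    and nonneg: "\<And>z. z \<in> S \<Longrightarrow> 0 \<le> u z"
    and lap: "\<And>z. z \<in> S \<Longrightarrow> 0 \<le> laplacian u z" "\<And>z. z \<in> S \<Longrightarrow> laplacian u z \<le> L * u z"
    and L: "0 \<le> L"
  shows "cap_integral u x 0 \<le> cap_integral u x s"
    and "cap_integral u x s \<le> exp (L * s\<^sup>2 / 8) * cap_integral u x 0"
proof -
  define K where "K t = integral UNIV (\<lambda>y. laplacian u (x + t *\<^sub>R y) * (cap y)\<^sup>2)" for t
  have D: "(cap_integral u x has_real_derivative t / 4 * K t) (at t)" if "\<bar>t\<bar> < r" for t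
    unfolding K_def by (rule has_real_derivative_cap_integral[OF u S that])
  have int: "(\<lambda>y. laplacian u (x + t *\<^sub>R y) * (cap y)\<^sup>2) integrable_on UNIV"
      "(\<lambda>y. u (x + t *\<^sub>R y) * cap y) integrable_on UNIV" if "\<bar>t\<bar> < r" for t
    using scaled_cap_integrable[OF Ck_on_2_laplacian_continuous[OF u] S that, of 2]
      scaled_cap_integrable[OF Ck_on_2_continuous[OF u] S that, of 1] by auto
  have in_S: "x + t *\<^sub>R y \<in> S \<or> cap y = 0" if "\<bar>t\<bar> < r" for t y
    using scaled_point_in[OF S that, of y] cap_eq_0[of y] real_DIM_ge_1[where 'a='a] by linarith
  have K0: "0 \<le> K t" if t: "\<bar>t\<bar> < r" for t
    unfolding K_def by (rule integral_nonneg[OF int(1)[OF t]]) (metis in_S[OF t] lap(1) mult_eq_0_iff mult_nonneg_nonneg order_refl zero_eq_power2 zero_le_power2)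
  have K1: "K t \<le> L * cap_integral u x t" if t: "\<bar>t\<bar> < r" for t
  proof -
    have "laplacian u (x + t *\<^sub>R y) * (cap y)\<^sup>2 \<le> L * (u (x + t *\<^sub>R y) * cap y)" for y
    proof (cases "cap y = 0")
      case False
      then have S: "x + t *\<^sub>R y \<in> S" using in_S[OF t] by blast
      have "laplacian u (x + t *\<^sub>R y) * (cap y)\<^sup>2 \<le> laplacian u (x + t *\<^sub>R y) * cap y"
        using mult_left_le[OF cap_le_1 cap_nonneg, of y] lap(1)[OF S]
        by (intro mult_left_mono) (auto simp: power2_eq_square)
      also have "\<dots> \<le> L * u (x + t *\<^sub>R y) * cap y"
        using lap(2)[OF S] cap_nonneg by (intro mult_right_mono) auto
      finally show ?thesis by (simp add: mult_ac)
    qed simp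
    then have "K t \<le> integral UNIV (\<lambda>y. L * (u (x + t *\<^sub>R y) * cap y))"
      unfolding K_def using int[OF t] by (intro integral_le integrable_on_mult_right) auto
    then show ?thesis by (simp add: cap_integral_def)
  qed
  show "cap_integral u x 0 \<le> cap_integral u x s"
  proof (rule DERIV_nonneg_imp_nondecreasing[OF s(1)])
    fix t assume "0 \<le> t" "t \<le> s"
    then show "\<exists>y. (cap_integral u x has_real_derivative y) (at t) \<and> 0 \<le> y"
      using D[of t] K0[of t] s by (intro exI[of _ "t / 4 * K t"]) auto
  qed
  \<comment> \<open>Gronwall: the integrating factor \<open>exp(- L t\<^sup>2 / 8)\<close> makes the average nonincreasing\<close>
  let ?G = "\<lambda>t. cap_integral u x t * exp (- (L * t\<^sup>2 / 8))"
  have "?G s \<le> ?G 0"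
  proof (rule DERIV_nonpos_imp_nonincreasing[OF s(1)])
    fix t assume t: "0 \<le> t" "t \<le> s"
    then have r: "\<bar>t\<bar> < r" using s by simp
    have "(?G has_real_derivative
        t / 4 * (K t - L * cap_integral u x t) * exp (- (L * t\<^sup>2 / 8))) (at t)"
      using D[OF r] by (auto intro!: derivative_eq_intros simp: field_simps)
    moreover have "t / 4 * (K t - L * cap_integral u x t) * exp (- (L * t\<^sup>2 / 8)) \<le> 0"
      using K1[OF r] t by (intro mult_nonpos_nonneg mult_nonneg_nonpos) auto
    ultimately show "\<exists>y. (?G has_real_derivative y) (at t) \<and> y \<le> 0" by blast
  qed
  then show "cap_integral u x s \<le> exp (L * s\<^sup>2 / 8) * cap_integral u x 0"
    by (simp add: exp_minus field_simps)
qed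

section \<open>Harnack inequality at a fixed scale\<close>

lemma integral_cap_pos: "0 < integral UNIV (cap :: 'a::euclidean_space \<Rightarrow> real)"
proof -
  have cont: "continuous_on A cap" for A :: "'a set"
    by (intro continuous_on_cap continuous_on_id)
  have int: "cap integrable_on (UNIV :: 'a set)"
    by (rule integrable_on_UNIV_if_supported) (auto simp: cap_eq_0 cont)
  have "integral UNIV (cap :: 'a \<Rightarrow> real) \<noteq> 0"
  proof
    assume "integral UNIV (cap :: 'a \<Rightarrow> real) = 0"
    then have "((cap :: 'a \<Rightarrow> real) has_integral 0) support_box"
      using int has_integral_support_box_iff[of "cap :: 'a \<Rightarrow> real" 0]
      by (simp add: has_integral_iff cap_eq_0)
    then have "cap (0::'a) = 0"
      by (intro has_integral_0_cbox_imp_0[OF cont]) (auto simp: cap_nonneg box_ne_empty mem_box)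
    then show False by (simp add: cap_def)
  qed
  then show ?thesis using integral_nonneg[OF int] cap_nonneg by force
qed

text \<open>
  Both values of \<open>u\<close> are compared with averages: \<open>u x\<close> is at most its average of radius \<open>r\<close>, and
  \<open>u z\<close> is, up to \<open>exp(2 L r\<^sup>2)\<close>, at least its average of radius \<open>4 r\<close>. In coordinates centred at
  \<open>z\<close> and scaled by \<open>4 r\<close>, the ball of radius \<open>r\<close> about \<open>x\<close> lies in the ball of radius \<open>1/2\<close>,
  where \<open>cap \<ge> 3/4\<close>; this accounts for the factor \<open>4/3\<close>, and the change of scale for
  \<open>4 ^ DIM('a)\<close>. The averages need \<open>S\<close> to contain balls of radius strictly more than
  \<open>4 * DIM('a)\<close> times their own; \<open>5 r > 4 r\<close> leads to the number \<open>20\<close>.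
\<close>
lemma local_harnack:
  fixes u :: "'a::euclidean_space \<Rightarrow> real"
  assumes u: "Ck_on 2 u S" and r: "0 < r" and xz: "dist x z \<le> r"
    and S: "ball x (20 * real DIM('a) * r) \<subseteq> S" "ball z (20 * real DIM('a) * r) \<subseteq> S"
    and nonneg: "\<And>w. w \<in> S \<Longrightarrow> 0 \<le> u w"
    and lap: "\<And>w. w \<in> S \<Longrightarrow> 0 \<le> laplacian u w" "\<And>w. w \<in> S \<Longrightarrow> laplacian u w \<le> L * u w"
    and L: "0 \<le> L"
  shows "u x \<le> 4/3 * 4 ^ DIM('a) * exp (2 * L * r\<^sup>2) * u z"
proof -
  let ?c = "integral UNIV (cap :: 'a \<Rightarrow> real)"
  let ?m = "(1 / (4 * r)) *\<^sub>R (x - z)"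
  have Sx: "ball x (4 * real DIM('a) * (5 * r)) \<subseteq> S" and Sz: "ball z (4 * real DIM('a) * (5 * r)) \<subseteq> S"
    using S by (simp_all add: mult_ac)
  define f where "f v = u (z + (4 * r) *\<^sub>R v) * cap v" for v
  have f0: "0 \<le> f v" for v
  proof (cases "norm v < 1")
    case True
    then have "z + (4 * r) *\<^sub>R v \<in> S"
      using r real_DIM_ge_1[where 'a='a] by (intro scaled_point_in[OF Sz]) linarith+
    then show ?thesis by (simp add: f_def nonneg cap_nonneg)
  qed (simp add: f_def cap_eq_0)
  have "(f has_integral cap_integral u z (4 * r)) UNIV"
    using scaled_cap_integrable[OF Ck_on_2_continuous[OF u] Sz, of "4 * r" 1] r
    unfolding f_def cap_integral_def by (intro integrable_integral) auto
  then have g: "((\<lambda>y. f ((1/4) *\<^sub>R y + ?m)) has_integral cap_integral u z (4 * r) / (1/4) ^ DIM('a)) UNIV"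
    by (rule has_integral_UNIV_affinity) (auto simp: f_def cap_eq_0)
  have le: "u (x + r *\<^sub>R y) * cap y \<le> 4/3 * f ((1/4) *\<^sub>R y + ?m)" for y
  proof (cases "norm y < 1")
    case True
    have "norm ?m \<le> 1/4"
      using xz r unfolding norm_scaleR by (simp add: dist_norm field_simps)
    then have "norm ((1/4) *\<^sub>R y + ?m) \<le> 1/2"
      using True norm_triangle_ineq[of "(1/4) *\<^sub>R y" ?m] by simp
    then have cap: "3/4 \<le> cap ((1/4) *\<^sub>R y + ?m)" by (rule cap_ge)
    have "x + r *\<^sub>R y \<in> S"
      using r True real_DIM_ge_1[where 'a='a] by (intro scaled_point_in[OF Sx]) linarith+
    then have u0: "0 \<le> u (x + r *\<^sub>R y)" by (rule nonneg)
    have "u (x + r *\<^sub>R y) * cap y \<le> u (x + r *\<^sub>R y) * (4/3 * cap ((1/4) *\<^sub>R y + ?m))"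
      using cap cap_le_1[of y] by (intro mult_left_mono u0) linarith
    also have "z + (4 * r) *\<^sub>R ((1/4) *\<^sub>R y + ?m) = x + r *\<^sub>R y"
      using r by (simp add: scaleR_add_right)
    then have "u (x + r *\<^sub>R y) * (4/3 * cap ((1/4) *\<^sub>R y + ?m)) = 4/3 * f ((1/4) *\<^sub>R y + ?m)"
      by (simp add: f_def)
    finally show ?thesis .
  qed (use f0 in \<open>simp add: cap_eq_0\<close>)
  have "?c * u x \<le> cap_integral u x r"
    using cap_integral_bounds(1)[OF u Sx _ _ nonneg lap L, of r] r by (simp add: cap_integral_0 mult_ac)
  also have "\<dots> \<le> 4/3 * (cap_integral u z (4 * r) / (1/4) ^ DIM('a))"
  proof (rule has_integral_le[OF _ has_integral_mult_right[OF g] le])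
    show "((\<lambda>y. u (x + r *\<^sub>R y) * cap y) has_integral cap_integral u x r) UNIV"
      using scaled_cap_integrable[OF Ck_on_2_continuous[OF u] Sx, of r 1] r
      unfolding cap_integral_def by (intro integrable_integral) auto
  qed
  also have "\<dots> = 4/3 * 4 ^ DIM('a) * cap_integral u z (4 * r)"
    by (simp add: power_divide)
  also have "\<dots> \<le> 4/3 * 4 ^ DIM('a) * (exp (2 * L * r\<^sup>2) * (u z * ?c))"
    using cap_integral_bounds(2)[OF u Sz _ _ nonneg lap L, of "4 * r"] r
    by (intro mult_left_mono) (auto simp: cap_integral_0 power_mult_distrib mult_ac)
  finally have "?c * u x \<le> ?c * (4/3 * 4 ^ DIM('a) * exp (2 * L * r\<^sup>2) * u z)"
    by (simp add: mult_ac)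
  then show ?thesis using integral_cap_pos[where 'a='a] by (simp only: mult_le_cancel_left_pos)
qed

section \<open>From the equation almost everywhere to pointwise bounds\<close>

lemma nonneg_if_AE_nonneg:
  fixes f :: "'a::euclidean_space \<Rightarrow> real"
  assumes "open S" and "continuous_on S f" and AE: "AE x in lebesgue_on S. 0 \<le> f x" and "x \<in> S"
  shows "0 \<le> f x"
proof -
  have "open (S \<inter> f -` {..<0})"
    using assms(1,2) by (intro continuous_open_preimage) auto
  moreover have "AE x \<in> S in lebesgue. x \<in> - (S \<inter> f -` {..<0})"
    using AE \<open>open S\<close> by (subst (asm) AE_restrict_space_iff) (auto elim: eventually_mono)
  ultimately have "x \<in> - (S \<inter> f -` {..<0})"
    by (intro mem_closed_if_AE_lebesgue_open[OF \<open>open S\<close> _ _ \<open>x \<in> S\<close>] closed_Compl)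
  with \<open>x \<in> S\<close> show ?thesis by auto
qed

text \<open>
  The potential is only measurable, so the equation cannot be extended from almost every point to
  all points; the two inequalities can, as they involve only continuous functions.
\<close>
lemma C2_solution_laplacian_bounds:
  fixes u :: "'a::euclidean_space \<Rightarrow> real"
  assumes "open S" and sol: "C2_solution S p lam u" and u: "\<And>x. x \<in> S \<Longrightarrow> 0 \<le> u x" and "0 \<le> lam"
    and p: "AE x in lebesgue_on S. 0 \<le> p x" "AE x in lebesgue_on S. p x \<le> M"
    and x: "x \<in> S"
  shows "0 \<le> laplacian u x" and "laplacian u x \<le> (lam + M) * u x"
proof -
  have C2: "Ck_on 2 u S" and eq: "AE x in lebesgue_on S. - laplacian u x + (lam + p x) * u x = 0"
    using sol by (auto simp: C2_solution_def)
  have in_S: "AE x in lebesgue_on S. x \<in> S"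
    by (rule AE_I2) simp
  show "0 \<le> laplacian u x"
  proof (rule nonneg_if_AE_nonneg[OF \<open>open S\<close> Ck_on_2_laplacian_continuous[OF C2] _ x])
    show "AE x in lebesgue_on S. 0 \<le> laplacian u x"
      using eq p(1) in_S
    proof eventually_elim
      case (elim x)
      then have "laplacian u x = (lam + p x) * u x" by linarith
      moreover have "0 \<le> (lam + p x) * u x" using elim(2,3) u \<open>0 \<le> lam\<close> by simp
      ultimately show ?case by simp
    qed
  qed
  have "0 \<le> (lam + M) * u x - laplacian u x"
  proof (rule nonneg_if_AE_nonneg[OF \<open>open S\<close> _ _ x])
    show "continuous_on S (\<lambda>x. (lam + M) * u x - laplacian u x)"
      by (intro continuous_intros Ck_on_2_laplacian_continuous[OF C2] Ck_on_2_continuous[OF C2])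
    show "AE x in lebesgue_on S. 0 \<le> (lam + M) * u x - laplacian u x"
      using eq p(2) in_S
    proof eventually_elim
      case (elim x)
      then have "(lam + M) * u x - laplacian u x = (M - p x) * u x" by (simp add: algebra_simps)
      then show ?case using elim u by simp
    qed
  qed
  then show "laplacian u x \<le> (lam + M) * u x" by simp
qed

section \<open>Chains of fixed length\<close>

text \<open>
  The point is that \<open>N\<close> is chosen before \<open>B\<close> and \<open>u\<close>. Being comparable with some exponent
  uniform in \<open>B\<close> and \<open>u\<close> is an equivalence relation with open classes, so any two points of \<open>K\<close>
  are comparable, with an exponent depending on the points; a finite cover by balls of radius
  \<open>r\<close> makes the exponent uniform, at the price of one step to a centre at each end.
\<close>
lemma uniform_harnack_chain:
  fixes K :: "'a::metric_space set"
  assumes "compact K" "connected K" "0 < r"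
  obtains N where "\<And>(B::real) u x y. \<lbrakk>1 \<le> B; \<And>x. x \<in> K \<Longrightarrow> 0 \<le> u x;
      \<And>x y. \<lbrakk>x \<in> K; y \<in> K; dist x y \<le> r\<rbrakk> \<Longrightarrow> u x \<le> B * u y; x \<in> K; y \<in> K\<rbrakk> \<Longrightarrow> u x \<le> B ^ N * u y"
proof -
  define admissible :: "real \<Rightarrow> ('a \<Rightarrow> real) \<Rightarrow> bool" where "admissible B u \<longleftrightarrow>
      1 \<le> B \<and> (\<forall>x\<in>K. 0 \<le> u x) \<and> (\<forall>x\<in>K. \<forall>y\<in>K. dist x y \<le> r \<longrightarrow> u x \<le> B * u y)" for B u
  define R where "R n x y \<longleftrightarrow> (\<forall>B u. admissible B u \<longrightarrow> u x \<le> B ^ n * u y)" for n x y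
  have R_trans: "R (m + n) x z" if "R m x y" "R n y z" for m n x y z
    unfolding R_def
  proof (intro allI impI)
    fix B u assume a: "admissible B u"
    then have "u x \<le> B ^ m * u y" "u y \<le> B ^ n * u z"
      using that by (auto simp: R_def)
    moreover have "0 \<le> B ^ m" using a by (simp add: admissible_def)
    ultimately show "u x \<le> B ^ (m + n) * u z"
      using mult_left_mono[of "u y" "B ^ n * u z" "B ^ m"] by (simp add: power_add mult.assoc)
  qed
  have R_mono: "R n x y" if "R m x y" "m \<le> n" "y \<in> K" for m n x y
    unfolding R_def
  proof (intro allI impI)
    fix B u assume a: "admissible B u"
    then have "B ^ m * u y \<le> B ^ n * u y"
      using that by (intro mult_right_mono power_increasing) (auto simp: admissible_def)
    with a that(1) show "u x \<le> B ^ n * u y"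
      unfolding R_def by force
  qed
  have R_near: "R 1 x y" if "x \<in> K" "y \<in> K" "dist x y \<le> r" for x y
    using that by (auto simp: R_def admissible_def)
  have connect: "\<exists>n. R n x y \<and> R n y x" if "x \<in> K" "y \<in> K" for x y
  proof (rule connected_equivalence_relation[OF \<open>connected K\<close> that])
    fix x y z assume "\<exists>n. R n x y \<and> R n y x" "\<exists>n. R n y z \<and> R n z y"
    then obtain m n where "R m x y" "R m y x" "R n y z" "R n z y" by blast
    then have "R (m + n) x z \<and> R (m + n) z x"
      using R_trans by (metis add.commute)
    then show "\<exists>n. R n x z \<and> R n z x" ..
  next
    fix x assume x: "x \<in> K"
    have "openin (top_of_set K) (K \<inter> ball x r)" by (simp add: openin_open_Int)
    then show "\<exists>T. openin (top_of_set K) T \<and> x \<in> T \<and> (\<forall>y\<in>T. \<exists>n. R n x y \<and> R n y x)"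
    proof (intro exI[of _ "K \<inter> ball x r"] conjI ballI)
      fix y assume "y \<in> K \<inter> ball x r"
      then have "R 1 x y \<and> R 1 y x"
        using x R_near[of x y] R_near[of y x] by (auto simp: dist_commute)
      then show "\<exists>n. R n x y \<and> R n y x" ..
    qed (use x \<open>0 < r\<close> in auto)
  qed auto
  have "K \<subseteq> (\<Union>c\<in>K. ball c r)"
    using \<open>0 < r\<close> by auto
  then obtain F where F: "F \<subseteq> K" "finite F" "K \<subseteq> (\<Union>c\<in>F. ball c r)"
    using compactE_image[OF \<open>compact K\<close>, of K "\<lambda>c. ball c r"] by auto
  obtain n where n: "\<And>c d. c \<in> F \<Longrightarrow> d \<in> F \<Longrightarrow> R (n c d) c d"
    using connect F(1) by (metis subsetD)
  define N where "N = (\<Sum>c\<in>F. \<Sum>d\<in>F. n c d)"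
  have "n c d \<le> N" if "c \<in> F" "d \<in> F" for c d
  proof -
    have "n c d \<le> (\<Sum>d\<in>F. n c d)"
      using F(2) that by (intro member_le_sum) auto
    also have "\<dots> \<le> N"
      unfolding N_def using F(2) that by (intro member_le_sum[of c F "\<lambda>c. \<Sum>d\<in>F. n c d"]) auto
    finally show ?thesis .
  qed
  then have RN: "R N c d" if "c \<in> F" "d \<in> F" for c d
    using R_mono[OF n _ ] that F(1) by blast
  have "R (1 + N + 1) x y" if "x \<in> K" "y \<in> K" for x y
  proof -
    obtain c d where cd: "c \<in> F" "d \<in> F" "dist c x < r" "dist d y < r"
      using subsetD[OF F(3) \<open>x \<in> K\<close>] subsetD[OF F(3) \<open>y \<in> K\<close>] by auto
    then have "R 1 x c" "R 1 d y"
      using F(1) that R_near[of x c] R_near[of d y] by (auto simp: dist_commute)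
    then show ?thesis
      using RN[OF cd(1,2)] R_trans by blast
  qed
  then show ?thesis
    by (intro that[of "1 + N + 1"]) (auto simp: R_def admissible_def)
qed

section \<open>The Harnack inequality\<close>

theorem lemma3p1:
  fixes \<Omega> U :: "(real ^ 'd) set" and p :: "real ^ 'd \<Rightarrow> real"
  assumes "CARD('d) \<in> {1, 2, 3}"
    and "open \<Omega>" and "connected \<Omega>" and "\<Omega> \<noteq> {}" and "bounded \<Omega>"
    and "smooth_boundary \<Omega>"
    and "Linfty_on \<Omega> p" and "AE x in lebesgue_on \<Omega>. p x \<ge> 0"
    and "open U" and "connected U" and "U \<noteq> {}" and "compactly_contained U \<Omega>"
  shows "\<exists>C>0. \<forall>lam>0. \<forall>u :: real ^ 'd \<Rightarrow> real.
           C2_solution \<Omega> p lam u \<and> (\<forall>x\<in>\<Omega>. u x \<ge> 0) \<longrightarrow>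
           (SUP x\<in>U. u x) \<le> exp (C * (1 + lam)) * (INF x\<in>U. u x)"
proof -
  let ?d = "real DIM(real ^ 'd)"
  let ?K = "closure U"
  have K: "compact ?K" "connected ?K" "?K \<subseteq> \<Omega>"
    using assms(10,12) by (auto simp: compactly_contained_def connected_imp_connected_closure)
  obtain M0 where M0: "AE x in lebesgue_on \<Omega>. \<bar>p x\<bar> \<le> M0"
    using assms(7) by (auto simp: Linfty_on_def)
  define M where "M = max 0 M0"
  have p_le: "AE x in lebesgue_on \<Omega>. p x \<le> M"
    using M0 by (rule eventually_mono) (auto simp: M_def)
  obtain \<epsilon> where \<epsilon>: "0 < \<epsilon>" "(\<Union>x\<in>?K. ball x \<epsilon>) \<subseteq> \<Omega>"
    using compact_subset_open_imp_ball_epsilon_subset[OF K(1) assms(2) K(3)] by blast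
  define r where "r = \<epsilon> / (20 * ?d)"
  have d: "0 < ?d" by (simp only: of_nat_0_less_iff DIM_positive)
  then have r: "0 < r" "20 * ?d * r = \<epsilon>"
    using \<epsilon>(1) by (auto simp: r_def)
  obtain N where N: "\<And>(B::real) u x y. \<lbrakk>1 \<le> B; \<And>x. x \<in> ?K \<Longrightarrow> 0 \<le> u x;
      \<And>x y. \<lbrakk>x \<in> ?K; y \<in> ?K; dist x y \<le> r\<rbrakk> \<Longrightarrow> u x \<le> B * u y; x \<in> ?K; y \<in> ?K\<rbrakk> \<Longrightarrow> u x \<le> B ^ N * u y"
    using uniform_harnack_chain[OF K(1,2) r(1)] by blast
  \<comment> \<open>With \<open>L = lam + M\<close> the local Harnack constant is \<open>A * exp (2 * (lam + M) * r\<^sup>2)\<close>, and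
      \<open>c\<close> is chosen so that this is at most \<open>exp (c * (1 + lam))\<close>.\<close>
  define A where "A = (4/3 * 4 ^ DIM(real ^ 'd) :: real)"
  define c where "c = ln A + 2 * r\<^sup>2 * (M + 1)"
  have A: "1 \<le> A"
    unfolding A_def using one_le_power[of "4::real" "DIM(real ^ 'd)"] by linarith
  have M: "0 \<le> M" by (simp add: M_def)
  have c: "0 \<le> c" using A M by (simp add: c_def)
  \<comment> \<open>The summand \<open>1\<close> only serves to make the constant positive when \<open>N * c = 0\<close>.\<close>
  have "(SUP x\<in>U. u x) \<le> exp ((N * c + 1) * (1 + lam)) * (INF x\<in>U. u x)"
    if lam: "0 < lam" and sol: "C2_solution \<Omega> p lam u" and u: "\<And>x. x \<in> \<Omega> \<Longrightarrow> 0 \<le> u x"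
    for lam and u :: "real ^ 'd \<Rightarrow> real"
  proof -
    have lap: "0 \<le> laplacian u x" "laplacian u x \<le> (lam + M) * u x" if "x \<in> \<Omega>" for x
      using C2_solution_laplacian_bounds[OF assms(2) sol u _ assms(8) p_le that] lam by auto
    define B where "B = exp (c * (1 + lam))"
    have "u x \<le> B * u y" if "x \<in> ?K" "y \<in> ?K" "dist x y \<le> r" for x y
    proof -
      have "u x \<le> A * exp (2 * (lam + M) * r\<^sup>2) * u y"
        unfolding A_def
      proof (rule local_harnack[OF _ r(1) that(3)])
        show "ball x (20 * ?d * r) \<subseteq> \<Omega>" "ball y (20 * ?d * r) \<subseteq> \<Omega>"
          using \<epsilon>(2) that unfolding r(2) by auto
      qed (use sol u lap lam M in \<open>auto simp: C2_solution_def\<close>)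
      also have "A * exp (2 * (lam + M) * r\<^sup>2) = exp (ln A + 2 * r\<^sup>2 * (lam + M))"
        using A by (simp add: exp_add mult_ac)
      also have "\<dots> \<le> B"
      proof -
        have "ln A + 2 * r\<^sup>2 * (lam + M) \<le> ln A * (1 + lam) + 2 * r\<^sup>2 * ((M + 1) * (1 + lam))"
          using A lam M by (intro add_mono mult_left_mono) (auto simp: algebra_simps)
        then show ?thesis by (simp add: B_def c_def algebra_simps)
      qed
      finally show ?thesis
        using u[of y] K(3) that(2) by (auto intro: order_trans mult_right_mono)
    qed
    moreover have "1 \<le> B" using c lam by (simp add: B_def)
    ultimately have chain: "u x \<le> B ^ N * u y" if "x \<in> ?K" "y \<in> ?K" for x y
      using N[of B u x y] u K(3) that by blast
    have BN: "B ^ N \<le> exp ((N * c + 1) * (1 + lam))"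
      using lam by (simp add: B_def exp_of_nat_mult[symmetric] algebra_simps)
    define E where "E = exp ((N * c + 1) * (1 + lam))"
    have UK: "U \<subseteq> ?K" by (rule closure_subset)
    have le: "u x \<le> E * u y" if "x \<in> U" "y \<in> U" for x y
      using chain[of x y] BN u[of y] K(3) UK that mult_right_mono[OF BN, of "u y"]
      by (force simp: E_def)
    have "(SUP x\<in>U. u x) \<le> E * u y" if "y \<in> U" for y
      using le that assms(11) by (intro cSUP_least) auto
    then have "(SUP x\<in>U. u x) / E \<le> (INF x\<in>U. u x)"
      using assms(11) by (intro cINF_greatest) (auto simp: E_def field_simps)
    then show ?thesis by (simp add: E_def field_simps)
  qed
  moreover have "0 < N * c + 1" using c by (simp add: add_nonneg_pos)
  ultimately show ?thesis by blast
qed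

end
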